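(* Let $\alpha\in(0,1)$. Let $f\in C^1[0,1]$ with $f(0)=0$, and let $D\in C^1[0,1]$ satisfy $D(\rho)>0$ for $\rho\in(0,\alpha)$, $D(\rho)<0$ for $\rho\in(\alpha,1)$, and $D'(\alpha)<0$. Let $\ell^-\in[0,\alpha)$, $\ell^+\in(\alpha,1]$ and assume $$\frac{f(\alpha)-f(\ell^-)}{\alpha-\ell^-}=\frac{f(\ell^+)-f(\alpha)}{\ell^+-\alpha}$$ and $$f(\rho)>\frac{f(\alpha)-f(\ell^-)}{\alpha-\ell^-}(\rho-\alpha)+f(\alpha)\quad\text{for }\rho\in(\ell^-,\alpha),$$ $$f(\rho)<\frac{f(\ell^+)-f(\alpha)}{\ell^+-\alpha}(\rho-\alpha)+f(\alpha)\quad\text{for }\rho\in(\alpha,\ell^+).$$ For $\epsilon\in(0,1]$ let $\varphi_\epsilon$ be the unique profile of wavefront solutions to $$\rho_t+f(\rho)_x=(\epsilon D(\rho)\rho_x)_x,\qquad t\ge0,\ x\in\mathbb{R},$$ satisfying $\varphi_\epsilon(-\infty)=\ell^-$, $\varphi_\epsilon(+\infty)=\ell^+$ and $\varphi_\epsilon(0)=\alpha$, $\varphi_\epsilon(\xi)<\alpha$ for $\xi<0$, $\varphi_\epsilon(\xi)>\alpha$ for $\xi>0$. Then $$\lim_{\epsilon\to0+}\varphi_\epsilon(\xi)=\begin{cases}\ell^- & \text{if }\xi<0,\\ \ell^+ & \text{if }\xi>0.\end{cases}$$ The convergence is uniform in every interval $(-\infty,-\delta)$ and $(\delta,+\infty)$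 with $\delta>0$.
   Context: Consider an equation $\rho_t+f(\rho)_x=(E(\rho)\rho_x)_x$ with $E\in C^1[0,1]$ (here $E=\epsilon D$). Let $I\subseteq\mathbb{R}$ be an open interval and $\varphi\colon I\to[0,1]$ with $\varphi\in C(I)$ and $E(\varphi)\varphi'\in L^1_{\rm loc}(I)$. For all $(x,t)$ with $x-ct\in I$, the function $\rho(x,t)=\varphi(x-ct)$ is a traveling-wave solution with wave speed $c$ and profile $\varphi$ if $$\int_I\bigl(E(\varphi(\xi))\varphi'(\xi)-f(\varphi(\xi))+c\varphi(\xi)\bigr)\psi'(\xi)\,d\xi=0\quad\text{for every }\psi\in C_0^\infty(I).$$ It is global if $I=\mathbb{R}$. A wavefront solution from $\ell^-$ to $\ell^+$ is a global, bounded traveling-wave solution with a monotonic, non-constant profile $\varphi$ satisfying $\varphi(-\infty)=\ell^-$, $\varphi(+\infty)=\ell^+$. Monotonic is meant in the weak sense ($\xi_1<\xi_2$ implies $\varphi(\xi_1)\le\varphi(\xi_2)$). Existence and uniqueness of the profiles $\varphi_\epsilon$, for each $\epsilon\in(0,1]$, are known from the following existence result for wavefronts. Let $\alpha\in(0,1)$, $f\in C^1[0,1]$ with $f(0)=0$, $E\in C^1[0,1]$ with $E(\rho)>0$ for $\rho\in(0,\alpha)$ and $E(\rho)<0$ for $\rho\in(\alpha,1)$, and let $\ell^-\in[0,\alpha)$, $\ell^+\in(\alpha,1]$. Then the equation $\rho_t+f(\rho)_x=(E(\rho)\rho_x)_x$ admits a wavefront solution whose profile $\varphi$ satisfies $\varphi(-\infty)=\ell^-$,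 $\varphi(+\infty)=\ell^+$ if and only if $\frac{f(\alpha)-f(\ell^-)}{\alpha-\ell^-}=\frac{f(\ell^+)-f(\alpha)}{\ell^+-\alpha}$, $f(\rho)>\frac{f(\alpha)-f(\ell^-)}{\alpha-\ell^-}(\rho-\alpha)+f(\alpha)$ for $\rho\in(\ell^-,\alpha)$, and $f(\rho)<\frac{f(\ell^+)-f(\alpha)}{\ell^+-\alpha}(\rho-\alpha)+f(\alpha)$ for $\rho\in(\alpha,\ell^+)$; the profile is unique under the normalization $\varphi(0)=\alpha$, $\varphi(\xi)<\alpha$ for $\xi<0$, $\varphi(\xi)>\alpha$ for $\xi>0$. This is applied with $E=\epsilon D$; all of the profiles $\varphi_\epsilon$ have the same wave speed $c_{\ell^\pm}=\frac{f(\ell^+)-f(\ell^-)}{\ell^+-\ell^-}$. *)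

theory Defs
  imports "HOL-Analysis.Analysis"
begin

text \<open>
  Differentiability on a closed interval is one-sided at the endpoints, so that \<open>C1_on f {0..1}\<close>
  only depends on the values of \<open>f\<close> in \<open>[0,1]\<close>; the library's \<open>C1_differentiable_on\<close>
  requires two-sided derivatives.
\<close>

definition C1_on :: "(real \<Rightarrow> real) \<Rightarrow> real set \<Rightarrow> bool" where
  "C1_on f S \<longleftrightarrow>
     (\<exists>f'. (\<forall>x\<in>S. (f has_real_derivative f' x) (at x within S)) \<and> continuous_on S f')"

text \<open>The space $C_0^\infty(U)$; test functions are extended by zero to the whole line.\<close>

definition test_function :: "real set \<Rightarrow> (real \<Rightarrow> real) \<Rightarrow> bool" where
  "test_function U \<psi> \<longleftrightarrow>
     (\<forall>n x. (deriv ^^ n) \<psi> differentiable (at x)) \<and>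
     compact (closure {x. \<psi> x \<noteq> 0}) \<and> closure {x. \<psi> x \<noteq> 0} \<subseteq> U"

definition locally_integrable_on :: "(real \<Rightarrow> real) \<Rightarrow> real set \<Rightarrow> bool" where
  "locally_integrable_on g U \<longleftrightarrow>
     (\<forall>K. compact K \<and> K \<subseteq> U \<longrightarrow> set_integrable lebesgue K g)"

definition weak_derivative_on :: "real set \<Rightarrow> (real \<Rightarrow> real) \<Rightarrow> (real \<Rightarrow> real) \<Rightarrow> bool" where
  "weak_derivative_on U u v \<longleftrightarrow>
     locally_integrable_on u U \<and> locally_integrable_on v U \<and>
     (\<forall>\<psi>. test_function U \<psi> \<longrightarrow>
        (LINT \<xi>:U|lebesgue. u \<xi> * deriv \<psi> \<xi>) = - (LINT \<xi>:U|lebesgue. v \<xi> * \<psi> \<xi>))"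

text \<open>
  Profiles of traveling-wave solutions \<open>\<rho>(x,t) = \<phi>(x - c t)\<close> of
  \<open>\<rho>\<^sub>t + f(\<rho>)\<^sub>x = (E(\<rho>) \<rho>\<^sub>x)\<^sub>x\<close>.  The function \<open>v\<close> is \<open>\<phi>'\<close>.  It enters only through the
  product \<open>E(\<phi>) \<phi>'\<close>, and only this product is required to be locally integrable on \<open>I\<close>;
  accordingly \<open>\<phi>\<close> is required to have a weak derivative only on the open set where the diffusivity
  does not degenerate, while the product vanishes on the complement.  (Taking for \<open>\<phi>'\<close> merely a
  pointwise derivative existing almost everywhere would admit profiles with a singular continuous
  part, for which uniqueness fails.)
\<close>

definition traveling_wave_profile ::
  "(real \<Rightarrow> real) \<Rightarrow> (real \<Rightarrow> real) \<Rightarrow> real \<Rightarrow> real set \<Rightarrow> (real \<Rightarrow> real) \<Rightarrow> bool" where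
  "traveling_wave_profile f E c I \<phi> \<longleftrightarrow>
     open I \<and> is_interval I \<and> \<phi> ` I \<subseteq> {0..1} \<and> continuous_on I \<phi> \<and>
     (\<exists>v. weak_derivative_on {\<xi>\<in>I. E (\<phi> \<xi>) \<noteq> 0} \<phi> v \<and>
          locally_integrable_on (\<lambda>\<xi>. E (\<phi> \<xi>) * v \<xi>) I \<and>
          (\<forall>\<psi>. test_function I \<psi> \<longrightarrow>
             (LINT \<xi>:I|lebesgue. (E (\<phi> \<xi>) * v \<xi> - f (\<phi> \<xi>) + c * \<phi> \<xi>) * deriv \<psi> \<xi>) = 0))"

definition wavefront_profile ::
  "(real \<Rightarrow> real) \<Rightarrow> (real \<Rightarrow> real) \<Rightarrow> real \<Rightarrow> real \<Rightarrow> real \<Rightarrow> (real \<Rightarrow> real) \<Rightarrow> bool" where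
  "wavefront_profile f E c lm lp \<phi> \<longleftrightarrow>
     traveling_wave_profile f E c UNIV \<phi> \<and>
     bounded (range \<phi>) \<and> mono \<phi> \<and> \<not> \<phi> constant_on UNIV \<and>
     (\<phi> \<longlongrightarrow> lm) at_bot \<and> (\<phi> \<longlongrightarrow> lp) at_top"

definition normalized_at :: "real \<Rightarrow> (real \<Rightarrow> real) \<Rightarrow> bool" where
  "normalized_at \<alpha> \<phi> \<longleftrightarrow> \<phi> 0 = \<alpha> \<and> (\<forall>\<xi><0. \<phi> \<xi> < \<alpha>) \<and> (\<forall>\<xi>>0. \<phi> \<xi> > \<alpha>)"

end

theory Submission
  imports Defs
begin

text \<open>
  Write \<open>s\<close> for the common slope of the two chords and \<open>h\<close> for the difference between \<open>f\<close> and the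
  chord through \<open>(\<alpha>, f \<alpha>)\<close>, so that \<open>h > 0\<close> on \<open>(lm, \<alpha>)\<close> and \<open>h < 0\<close> on \<open>(\<alpha>, lp)\<close>.  The idea is that
  the profile equation is first order and autonomous once it is integrated, and that \<open>\<epsilon>\<close> enters it
  only as a rescaling of the variable: wherever \<open>lm < \<phi>\<^sub>\<epsilon> < \<alpha>\<close> or \<open>\<alpha> < \<phi>\<^sub>\<epsilon> < lp\<close>,
  \<open>\<epsilon> \<phi>\<^sub>\<epsilon>' = h(\<phi>\<^sub>\<epsilon>) / D(\<phi>\<^sub>\<epsilon>)\<close>, with a positive right-hand side that does not depend on \<open>\<epsilon>\<close>.

  Let \<open>G\<close> be a primitive of \<open>D / h\<close> on \<open>(lm, \<alpha>)\<close>.  Along \<open>\<phi>\<^sub>\<epsilon>\<close> it is a clock that runs at speed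
  \<open>1/\<epsilon>\<close>.  It is bounded above on \<open>(lm, \<alpha>)\<close>, since \<open>\<phi>\<^sub>1\<close> reaches \<open>\<alpha>\<close> in finite time.
  If \<open>\<phi>\<^sub>\<epsilon>(-\<delta>) > r > lm\<close>, the clock would gain \<open>\<delta> / (2 \<epsilon>)\<close> between \<open>-\<delta>\<close> and \<open>-\<delta>/2\<close>, starting above
  \<open>G(r)\<close>; this exceeds the bound for small \<open>\<epsilon>\<close>.
  By monotonicity \<open>\<phi>\<^sub>\<epsilon> \<le> r\<close> on all of \<open>(-\<infinity>, -\<delta>)\<close>, which is the uniform convergence on the left
  (\<open>autonomous_layer_collapse\<close>).  The right half is the same statement for \<open>- \<phi>\<^sub>\<epsilon>(-\<xi>)\<close>.

  The remaining work is to obtain this differential equation from the weak formulation, with \<open>E = \<epsilon> D\<close>.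
  By the du Bois-Reymond lemma \<open>E(\<phi>) \<phi>' - f(\<phi>) + c \<phi>\<close> is almost everywhere equal to a constant \<open>-K\<close>;
  where \<open>E(\<phi>)\<close> does not vanish, the weak derivative of \<open>\<phi>\<close> is thus given by a continuous function
  and \<open>\<phi>\<close> is a classical solution (\<open>traveling_wave_first_integral\<close>).  The numbers \<open>c\<close> and \<open>K\<close> are
  then found from \<open>g(r) = f(r) - c r - K\<close> (\<open>wavefront_profile_ode\<close>).  Since \<open>\<phi>\<close> increases,
  \<open>g(\<phi>) = E(\<phi>) \<phi>'\<close> cannot have the sign opposite to \<open>E(\<phi>)\<close>, which changes at \<open>\<alpha>\<close>, so \<open>g(\<alpha>) = 0\<close>.
  Also \<open>g(lm) = 0\<close>: if \<open>\<phi>\<close> attains \<open>lm\<close>, its flux vanishes on a half-line, and if it does not, it would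
  otherwise have a slope bounded away from zero near \<open>-\<infinity>\<close>.  Hence \<open>c = s\<close> and \<open>g = h\<close>
  for every \<open>\<epsilon>\<close>.
\<close>

section \<open>Smooth functions with compact support\<close>

text \<open>
  The classical smooth function that is flat at the origin is \<open>flat 0\<close>.  The powers make the linear span
  of the family closed under differentiation: \<open>flat n\<close> leads to \<open>flat (n + 1)\<close> and \<open>flat (n + 2)\<close>.
\<close>
definition flat :: "nat \<Rightarrow> real \<Rightarrow> real" where
  "flat n x = (if x \<le> 0 then 0 else inverse x ^ n * exp (- inverse x))"

lemma flat_tendsto_0: "(flat n \<longlongrightarrow> 0) (at 0)"
proof -
  have "((\<lambda>y::real. y ^ n / exp y) \<longlongrightarrow> 0) at_top"
    by (rule tendsto_power_div_exp_0)
  then have "((\<lambda>x::real. inverse x ^ n / exp (inverse x)) \<longlongrightarrow> 0) (at_right 0)"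
    by (rule filterlim_compose) (rule filterlim_inverse_at_top_right)
  then have "(flat n \<longlongrightarrow> 0) (at_right 0)"
  proof (rule Lim_transform_eventually)
    show "\<forall>\<^sub>F x in at_right 0. inverse x ^ n / exp (inverse x) = flat n x"
      by (auto simp: flat_def eventually_at_filter exp_minus field_simps)
  qed
  moreover have "(flat n \<longlongrightarrow> 0) (at_left 0)"
    by (rule Lim_transform_eventually[OF tendsto_const])
       (auto simp: flat_def eventually_at_filter)
  ultimately show ?thesis by (simp add: filterlim_split_at)
qed

lemma flat_has_derivative:
  "(flat n has_real_derivative flat (n + 2) x - real n * flat (n + 1) x) (at x)"
proof (cases x "0::real" rule: linorder_cases)
  case less
  have "((\<lambda>_. 0) has_real_derivative 0) (at x)" by simp
  then have "(flat n has_real_derivative 0) (at x)"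
    by (rule has_field_derivative_transform_within_open[where S="{..<0}"])
       (use less in \<open>auto simp: flat_def\<close>)
  then show ?thesis using less by (simp add: flat_def)
next
  case equal
  have "(flat (n + 1) \<longlongrightarrow> 0) (at 0)" by (rule flat_tendsto_0)
  then have "((\<lambda>h. (flat n (0 + h) - flat n 0) / h) \<longlongrightarrow> 0) (at 0)"
    by (rule Lim_transform_eventually)
       (auto simp: flat_def eventually_at_filter field_simps)
  then show ?thesis using equal by (simp add: DERIV_def flat_def)
next
  case greater
  have "((\<lambda>x. inverse x ^ n * exp (- inverse x)) has_real_derivative
          flat (n + 2) x - real n * flat (n + 1) x) (at x)"
    using greater
    by (auto intro!: derivative_eq_intros simp: flat_def)
       (cases n; simp add: field_simps power2_eq_square)
  then show ?thesis
    by (rule has_field_derivative_transform_within_open[where S="{0<..}"])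
       (use greater in \<open>auto simp: flat_def\<close>)
qed

text \<open>
  A set of functions that contains a derivative of each of its elements consists of smooth functions.
  Closing the affine substitutions of the functions \<open>flat n\<close> under sums and products gives such a set.
  It contains the bumps from which the test functions below are built.
\<close>
inductive_set flat_algebra :: "(real \<Rightarrow> real) set" where
  const: "(\<lambda>_. c) \<in> flat_algebra"
| flat: "(\<lambda>x. flat n (a * x + b)) \<in> flat_algebra"
| add: "u \<in> flat_algebra \<Longrightarrow> v \<in> flat_algebra \<Longrightarrow> (\<lambda>x. u x + v x) \<in> flat_algebra"
| mult: "u \<in> flat_algebra \<Longrightarrow> v \<in> flat_algebra \<Longrightarrow> (\<lambda>x. u x * v x) \<in> flat_algebra"

lemma flat_algebra_derivative:
  assumes "u \<in> flat_algebra"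
  shows "\<exists>u'\<in>flat_algebra. \<forall>x. (u has_real_derivative u' x) (at x)"
  using assms
proof induction
  case (const c)
  show ?case by (intro bexI[of _ "\<lambda>_. 0"] flat_algebra.const) simp
next
  case (flat n a b)
  let ?u' = "\<lambda>x. a * (flat (n + 2) (a * x + b) + (- real n) * flat (n + 1) (a * x + b))"
  have "((\<lambda>x. flat n (a * x + b)) has_real_derivative ?u' x) (at x)" for x
  proof -
    have "((\<lambda>x. a * x + b) has_real_derivative a) (at x)"
      by (auto intro!: derivative_eq_intros)
    from DERIV_chain2[OF flat_has_derivative this] show ?thesis
      by (simp add: algebra_simps)
  qed
  moreover have "?u' \<in> flat_algebra"
    by (intro flat_algebra.intros)
  ultimately show ?case by (intro bexI[of _ ?u']) auto
next
  case (add u v)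
  then obtain u' v' where "u' \<in> flat_algebra" "v' \<in> flat_algebra"
    "\<And>x. (u has_real_derivative u' x) (at x)" "\<And>x. (v has_real_derivative v' x) (at x)" by auto
  then show ?case
    by (intro bexI[of _ "\<lambda>x. u' x + v' x"] flat_algebra.intros) (auto intro!: derivative_eq_intros)
next
  case (mult u v)
  then obtain u' v' where *: "u' \<in> flat_algebra" "v' \<in> flat_algebra"
    "\<And>x. (u has_real_derivative u' x) (at x)" "\<And>x. (v has_real_derivative v' x) (at x)" by auto
  show ?case
    by (intro bexI[of _ "\<lambda>x. u' x * v x + u x * v' x"] flat_algebra.intros * mult)
       (auto intro!: derivative_eq_intros *)
qed

lemma flat_algebra_deriv: "u \<in> flat_algebra \<Longrightarrow> deriv u \<in> flat_algebra"
  using flat_algebra_derivative[of u] by (metis DERIV_imp_deriv ext)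

lemma flat_algebra_differentiable: "u \<in> flat_algebra \<Longrightarrow> u differentiable (at x)"
  using flat_algebra_derivative[of u] real_differentiable_def by blast

lemma flat_algebra_smooth:
  assumes "u \<in> flat_algebra"
  shows "(deriv ^^ n) u differentiable (at x)"
proof -
  have "(deriv ^^ n) u \<in> flat_algebra"
    by (induction n) (use assms flat_algebra_deriv in auto)
  then show ?thesis by (rule flat_algebra_differentiable)
qed

lemma flat_algebra_continuous: "u \<in> flat_algebra \<Longrightarrow> continuous_on S u"
  by (meson continuous_at_imp_continuous_on differentiable_imp_continuous_within flat_algebra_differentiable)

lemma flat_algebra_antiderivative:
  assumes "\<eta> \<in> flat_algebra"
  shows "\<exists>\<Psi>. \<forall>x. (\<Psi> has_real_derivative \<eta> x) (at x)"
proof -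
  have "isCont \<eta> x" for x
    using flat_algebra_continuous[OF assms, of UNIV] by (simp add: continuous_on_eq_continuous_at)
  then have "\<exists>\<Psi>. \<forall>x. (\<Psi> has_vector_derivative \<eta> x) (at x)"
    using einterval_antiderivative[of "-\<infinity>" "\<infinity>" \<eta>] by auto
  then show ?thesis
    by (simp add: has_real_derivative_iff_has_vector_derivative)
qed

text \<open>
  Test functions are obtained from prescribed derivatives: vanishing mean makes the
  antiderivative return to zero at the right end of the support.
\<close>
lemma test_function_antiderivative:
  assumes \<eta>: "\<eta> \<in> flat_algebra" and st: "s < t" "{s..t} \<subseteq> U"
    and zero: "\<And>x. x \<notin> {s..t} \<Longrightarrow> \<eta> x = 0" and mean: "integral {s..t} \<eta> = 0"
  obtains \<psi> where "test_function U \<psi>" "deriv \<psi> = \<eta>"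
proof -
  obtain \<Psi> where \<Psi>: "\<And>x. (\<Psi> has_real_derivative \<eta> x) (at x)"
    using flat_algebra_antiderivative[OF \<eta>] by blast
  define \<psi> where "\<psi> x = \<Psi> x - \<Psi> s" for x
  have der: "(\<psi> has_real_derivative \<eta> x) (at x)" for x
    unfolding \<psi>_def by (auto intro!: derivative_eq_intros \<Psi>)
  have deriv: "deriv \<psi> = \<eta>"
    by (rule ext) (rule DERIV_imp_deriv[OF der])
  have cont: "continuous_on S \<psi>" for S
    using der by (meson DERIV_continuous continuous_at_imp_continuous_on)
  have smooth: "(deriv ^^ n) \<psi> differentiable (at x)" for n x
  proof (cases n)
    case 0
    then show ?thesis using der real_differentiable_def by auto
  next
    case (Suc m)
    then show ?thesis
      using flat_algebra_smooth[OF \<eta>, of m x] by (simp add: funpow_Suc_right deriv del: funpow.simps)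
  qed
  have "(\<eta> has_integral \<psi> t - \<psi> s) {s..t}"
    using st der by (intro fundamental_theorem_of_calculus)
      (auto simp: has_real_derivative_iff_has_vector_derivative[symmetric] intro: has_field_derivative_at_within)
  then have t: "\<psi> t = \<psi> s" using mean by (simp add: integral_unique)
  have s: "\<psi> s = 0" by (simp add: \<psi>_def)
  have "\<psi> x = 0" if "x \<notin> {s..t}" for x
  proof (cases "x < s")
    case True
    have "\<psi> s = \<psi> x"
      by (rule DERIV_isconst_end[OF True cont]) (use der zero in \<open>metis atLeastAtMost_iff not_le\<close>)
    then show ?thesis using s by simp
  next
    case False
    then have "t < x" using that by auto
    have "\<psi> x = \<psi> t"
      by (rule DERIV_isconst_end[OF \<open>t < x\<close> cont]) (use der zero in \<open>metis atLeastAtMost_iff not_le\<close>)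
    then show ?thesis using s t by simp
  qed
  then have "closure {x. \<psi> x \<noteq> 0} \<subseteq> {s..t}"
    by (intro closure_minimal) fastforce+
  moreover from this have "compact (closure {x. \<psi> x \<noteq> 0})"
    by (meson bounded_closed_interval bounded_subset closed_closure compact_eq_bounded_closed)
  ultimately have "test_function U \<psi>"
    unfolding test_function_def using smooth st by blast
  then show ?thesis using that deriv by blast
qed

definition bump :: "real \<Rightarrow> real \<Rightarrow> real \<Rightarrow> real \<Rightarrow> real" where
  "bump p q m x = flat 0 (m * (x - p)) * flat 0 (m * (q - x))"

lemma bump_flat_algebra: "bump p q m \<in> flat_algebra"
proof -
  have "bump p q m = (\<lambda>x. flat 0 (m * x + (- m * p)) * flat 0 ((- m) * x + m * q))"
    by (rule ext) (simp add: bump_def algebra_simps)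
  then show ?thesis by (simp only: flat_algebra.intros)
qed

lemma bump_range: "0 \<le> bump p q m x" "bump p q m x \<le> 1"
proof -
  have "0 \<le> flat 0 y" "flat 0 y \<le> 1" for y by (auto simp: flat_def)
  then show "0 \<le> bump p q m x" "bump p q m x \<le> 1"
    unfolding bump_def by (auto intro: mult_le_one)
qed

lemma bump_eq_0: "m > 0 \<Longrightarrow> x \<notin> {p<..<q} \<Longrightarrow> bump p q m x = 0"
  by (auto simp: bump_def flat_def mult_le_0_iff)

text \<open>
  Stretching the argument by \<open>m\<close> turns each factor \<open>exp (-1/y)\<close> into \<open>exp (-1/(m y))\<close>, which tends to
  \<open>1\<close> for \<open>y > 0\<close>, while the factor remains zero for \<open>y \<le> 0\<close>.
\<close>
lemma bump_tendsto_indicator: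
  "(\<lambda>n. bump p q (real (Suc n)) x) \<longlonglongrightarrow> indicator {p<..<q} x"
proof (cases "x \<in> {p<..<q}")
  case True
  have "(\<lambda>n. flat 0 (real (Suc n) * y)) \<longlonglongrightarrow> 1" if "y > 0" for y
  proof -
    have "(\<lambda>n. exp (- (inverse (real (Suc n)) * inverse y))) \<longlonglongrightarrow> exp (- (0 * inverse y))"
      by (intro tendsto_intros LIMSEQ_inverse_real_of_nat)
    moreover have "flat 0 (real (Suc n) * y) = exp (- (inverse (real (Suc n)) * inverse y))" for n
      using that mult_pos_pos[of "real (Suc n)" y] by (simp add: flat_def not_le[symmetric] del: of_nat_Suc)
    ultimately show ?thesis by simp
  qed
  from tendsto_mult[OF this[of "x - p"] this[of "q - x"]] True
  show ?thesis by (simp add: bump_def)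
next
  case False
  then show ?thesis using bump_eq_0[OF _ False] by simp
qed

section \<open>The du Bois-Reymond lemma\<close>
lemma set_lebesgue_integral_eq_of_support:
  fixes g :: "real \<Rightarrow> real"
  assumes "S \<subseteq> J" "\<And>x. x \<notin> S \<Longrightarrow> g x = 0"
  shows "(LINT x:J|M. g x) = (LINT x:S|M. g x)"
  unfolding set_lebesgue_integral_def
  by (rule Bochner_Integration.integral_cong) (use assms in \<open>auto simp: indicator_def\<close>)

lemma set_integrable_times_continuous:
  fixes u \<eta> :: "real \<Rightarrow> real"
  assumes u: "set_integrable lebesgue {s..t} u" and cont: "continuous_on {s..t} \<eta>"
  shows "set_integrable lebesgue {s..t} (\<lambda>x. u x * \<eta> x)"
proof -
  have "set_integrable lebesgue {s..t} (\<lambda>x. \<eta> x * u x)"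
  proof (rule absolutely_integrable_bounded_measurable_product_real)
    show "\<eta> \<in> borel_measurable (lebesgue_on {s..t})"
      by (rule continuous_imp_measurable_on_sets_lebesgue[OF cont]) simp
    show "bounded (\<eta> ` {s..t})"
      by (intro compact_imp_bounded compact_continuous_image cont compact_Icc)
  qed (use u in auto)
  then show ?thesis by (simp add: mult.commute)
qed

lemma integral_bump_limit:
  assumes u: "set_integrable lebesgue {p..q} u"
  shows "(\<lambda>n. LINT x:{p..q}|lebesgue. u x * bump p q (real (Suc n)) x) \<longlonglongrightarrow> integral {p..q} u"
proof -
  have int: "set_integrable lebesgue {p<..<q} u"
    by (rule set_integrable_subset[OF u]) auto
  have "(\<lambda>n. LINT x|lebesgue. indicator {p..q} x *\<^sub>R (u x * bump p q (real (Suc n)) x))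
          \<longlonglongrightarrow> (LINT x|lebesgue. indicator {p<..<q} x *\<^sub>R u x)"
  proof (rule integral_dominated_convergence[where w="\<lambda>x. norm (indicator {p..q} x *\<^sub>R u x)"])
    show "(\<lambda>x. indicator {p<..<q} x *\<^sub>R u x) \<in> borel_measurable lebesgue"
      using int by (simp add: set_integrable_def borel_measurable_integrable)
    show "(\<lambda>x. indicator {p..q} x *\<^sub>R (u x * bump p q (real (Suc n)) x)) \<in> borel_measurable lebesgue" for n
      using set_integrable_times_continuous[OF u flat_algebra_continuous[OF bump_flat_algebra]]
      by (simp only: set_integrable_def borel_measurable_integrable)
    show "integrable lebesgue (\<lambda>x. norm (indicator {p..q} x *\<^sub>R u x))"
      using u by (simp only: set_integrable_def integrable_norm)
    show "AE x in lebesgue. (\<lambda>n. indicator {p..q} x *\<^sub>R (u x * bump p q (real (Suc n)) x))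
             \<longlonglongrightarrow> indicator {p<..<q} x *\<^sub>R u x"
    proof (intro AE_I2)
      fix x
      have "(\<lambda>n. indicator {p..q} x *\<^sub>R (u x * bump p q (real (Suc n)) x))
             \<longlonglongrightarrow> indicator {p..q} x *\<^sub>R (u x * indicator {p<..<q} x)"
        by (intro tendsto_intros bump_tendsto_indicator)
      then show "(\<lambda>n. indicator {p..q} x *\<^sub>R (u x * bump p q (real (Suc n)) x))
             \<longlonglongrightarrow> indicator {p<..<q} x *\<^sub>R u x"
        by (auto simp: indicator_def split: if_splits)
    qed
    show "AE x in lebesgue. norm (indicator {p..q} x *\<^sub>R (u x * bump p q (real (Suc n)) x))
            \<le> norm (indicator {p..q} x *\<^sub>R u x)" for n
      using bump_range[of p q "real (Suc n)"]
      by (intro AE_I2) (auto simp: indicator_def abs_mult intro!: mult_left_le)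
  qed
  moreover have "(LINT x|lebesgue. indicator {p<..<q} x *\<^sub>R u x) = integral {p..q} u"
    using set_lebesgue_integral_eq_integral(2)[OF int] integral_open_interval_real[of p q u]
    by (simp add: set_lebesgue_integral_def)
  ultimately show ?thesis by (simp only: set_lebesgue_integral_def)
qed

text \<open>
  At almost every point an integrable function is the limit of its one-sided averages, and here all of
  these averages are equal to \<open>\<kappa>\<close>.
\<close>
lemma AE_eq_const_of_interval_integrals:
  fixes u :: "real \<Rightarrow> real"
  assumes u: "u integrable_on {p..q}"
    and avg: "\<And>x y. p \<le> x \<Longrightarrow> x < y \<Longrightarrow> y \<le> q \<Longrightarrow> integral {x..y} u = \<kappa> * (y - x)"
  shows "AE x in lebesgue. x \<in> {p<..<q} \<longrightarrow> u x = \<kappa>"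
proof -
  define w where "w x = (if x \<in> {p..q} then u x else 0)" for x
  have "w integrable_on UNIV"
    unfolding w_def using u by (simp only: integrable_restrict_UNIV)
  then have "w integrable_on cbox a b" for a b
    by (rule integrable_on_subcbox) simp
  then obtain N where N: "negligible N"
    "\<And>x e. \<lbrakk>x \<notin> N; 0 < e\<rbrakk> \<Longrightarrow> \<exists>d>0. \<forall>h. 0 < h \<and> h < d \<longrightarrow>
        norm (integral (cbox x (x + h *\<^sub>R One)) w /\<^sub>R h ^ DIM(real) - w x) < e"
    using integrable_ccontinuous_explicit[of w] by metis
  have "u x = \<kappa>" if x: "x \<in> {p<..<q}" "x \<notin> N" for x
  proof (rule ccontr)
    assume "u x \<noteq> \<kappa>"
    then have "0 < \<bar>u x - \<kappa>\<bar>" by simp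
    from N(2)[OF x(2) this] obtain d where d: "d > 0"
      "\<And>h. 0 < h \<Longrightarrow> h < d \<Longrightarrow> \<bar>integral {x..x + h} w / h - w x\<bar> < \<bar>u x - \<kappa>\<bar>"
      by (auto simp: divide_inverse mult.commute)
    define h where "h = min (d / 2) (q - x)"
    have h: "0 < h" "h < d" "x + h \<le> q" using d(1) x by (auto simp: h_def)
    have "integral {x..x + h} w = integral {x..x + h} u"
      by (rule integral_cong) (use x h in \<open>auto simp: w_def\<close>)
    also have "\<dots> = \<kappa> * h" using avg[of x "x + h"] x h by simp
    finally show False using d(2)[OF h(1,2)] h x by (simp add: w_def)
  qed
  moreover have "AE x in lebesgue. x \<notin> N"
    using N(1) by (simp add: negligible_iff_null_sets AE_not_in)
  ultimately show ?thesis by (auto elim: eventually_mono)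
qed

text \<open>
  Fix one bump \<open>\<theta>\<close> in \<open>J\<close>.  Every bump differs from a multiple of \<open>\<theta>\<close> by a function of mean zero, that
  is, by the derivative of a test function; hence \<open>u\<close> integrates against every bump like the constant
  \<open>\<kappa>\<close>, the weighted mean of \<open>u\<close> against \<open>\<theta>\<close>.  As bumps approximate indicators, the same holds for
  integrals over intervals.
\<close>
lemma du_Bois_Reymond:
  assumes J: "open J" "is_interval J" and u: "locally_integrable_on u J"
    and orth: "\<And>\<psi>. test_function J \<psi> \<Longrightarrow> (LINT x:J|lebesgue. u x * deriv \<psi> x) = 0"
  shows "\<exists>\<kappa>. AE x in lebesgue. x \<in> J \<longrightarrow> u x = \<kappa>"
proof (cases "J = {}")
  case False
  have int_u: "set_integrable lebesgue {s..t} u" if "{s..t} \<subseteq> J" for s t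
    using u that by (auto simp: locally_integrable_on_def)
  obtain p0 q0 where pq0: "p0 < q0" "{p0..q0} \<subseteq> J"
  proof -
    obtain x where "x \<in> J" using False by auto
    then obtain e where "e > 0" "cball x e \<subseteq> J" using J(1) open_contains_cball by blast
    then show ?thesis using that[of x "x + e"]
      by (auto simp: cball_eq_atLeastAtMost subset_eq)
  qed
  define \<theta> where "\<theta> = bump p0 q0 1"
  have \<theta>0: "\<theta> x = 0" if "x \<notin> {p0..q0}" for x
    unfolding \<theta>_def by (rule bump_eq_0) (use that in auto)
  have \<theta>: "\<theta> \<in> flat_algebra" unfolding \<theta>_def by (rule bump_flat_algebra)
  define m where "m = integral {p0..q0} \<theta>"
  have "m \<noteq> 0"
  proof
    assume "m = 0"
    then have "\<forall>x\<in>{p0..q0}. \<theta> x = 0"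
      unfolding m_def using flat_algebra_continuous[OF \<theta>] pq0(1) bump_range[of p0 q0 1]
      by (subst (asm) integral_eq_0_iff) (auto simp: \<theta>_def)
    moreover have "\<theta> ((p0 + q0) / 2) \<noteq> 0"
      using pq0(1) by (simp add: \<theta>_def bump_def flat_def field_simps)
    ultimately show False using pq0(1) by auto
  qed
  define \<kappa> where "\<kappa> = (LINT x:{p0..q0}|lebesgue. u x * \<theta> x) / m"
  \<comment> \<open>test against \<open>\<eta>\<close>, corrected by the multiple of \<open>\<theta>\<close> that makes its mean vanish\<close>
  have main: "(LINT x:{p..q}|lebesgue. u x * \<eta> x) = \<kappa> * (LINT x:{p..q}|lebesgue. \<eta> x)"
    if pq: "p < q" "{p..q} \<subseteq> J" and \<eta>: "\<eta> \<in> flat_algebra" and \<eta>0: "\<And>x. x \<notin> {p..q} \<Longrightarrow> \<eta> x = 0"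
    for p q \<eta>
  proof -
    define s t where "s = min p p0" and "t = max q q0"
    have st: "s < t" "{p..q} \<subseteq> {s..t}" "{p0..q0} \<subseteq> {s..t}"
      using pq pq0 by (auto simp: s_def t_def)
    have sJ: "s \<in> J" and tJ: "t \<in> J" using pq pq0 by (auto simp: s_def t_def min_def max_def)
    then have stJ: "{s..t} \<subseteq> J"
      using mem_is_interval_1_I[OF J(2) sJ tJ] by auto
    note integrable = set_integrable_times_continuous[OF int_u[OF stJ] flat_algebra_continuous]
    have one: "set_integrable lebesgue {s..t} \<zeta>" if "\<zeta> \<in> flat_algebra" for \<zeta>
      by (rule absolutely_integrable_continuous_real[OF flat_algebra_continuous[OF that]])
    define M where "M = (LINT x:{p..q}|lebesgue. \<eta> x)"
    have M: "M = (LINT x:{s..t}|lebesgue. \<eta> x)"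
      unfolding M_def by (rule set_lebesgue_integral_eq_of_support[symmetric]) (use st \<eta>0 in auto)
    have "m = (LINT x:{p0..q0}|lebesgue. \<theta> x)"
      unfolding m_def using set_integrable_subset[OF one[OF \<theta>] _ st(3)]
      by (simp add: set_lebesgue_integral_eq_integral(2))
    also have "\<dots> = (LINT x:{s..t}|lebesgue. \<theta> x)"
      by (rule set_lebesgue_integral_eq_of_support[symmetric]) (use st \<theta>0 in auto)
    finally have m: "m = (LINT x:{s..t}|lebesgue. \<theta> x)" .
    define \<zeta> where "\<zeta> x = \<eta> x + (- (M / m)) * \<theta> x" for x
    have \<zeta>: "\<zeta> \<in> flat_algebra"
      unfolding \<zeta>_def by (intro flat_algebra.intros \<eta> \<theta>)
    have \<zeta>0: "\<zeta> x = 0" if "x \<notin> {s..t}" for x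
      using that st \<eta>0[of x] \<theta>0[of x] unfolding \<zeta>_def by auto
    have lin: "(LINT x:{s..t}|lebesgue. g x + c * h x) =
        (LINT x:{s..t}|lebesgue. g x) + c * (LINT x:{s..t}|lebesgue. h x)"
      if "set_integrable lebesgue {s..t} g" "set_integrable lebesgue {s..t} h" for g h :: "real \<Rightarrow> real" and c
      using that by (simp add: set_integral_add)
    have "integral {s..t} \<zeta> = (LINT x:{s..t}|lebesgue. \<zeta> x)"
      by (simp add: set_lebesgue_integral_eq_integral(2) one[OF \<zeta>])
    also have "\<dots> = M + (- (M / m)) * m"
      unfolding \<zeta>_def lin[OF one[OF \<eta>] one[OF \<theta>]] by (simp add: M m)
    finally have "integral {s..t} \<zeta> = 0" using \<open>m \<noteq> 0\<close> by simp
    then obtain \<psi> where \<psi>: "test_function J \<psi>" "deriv \<psi> = \<zeta>"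
      using test_function_antiderivative[OF \<zeta> st(1) stJ \<zeta>0] by blast
    have "0 = (LINT x:J|lebesgue. u x * \<zeta> x)"
      using orth[OF \<psi>(1)] \<psi>(2) by simp
    also have "\<dots> = (LINT x:{s..t}|lebesgue. u x * \<zeta> x)"
      by (rule set_lebesgue_integral_eq_of_support) (use stJ \<zeta>0 in auto)
    also have "\<dots> = (LINT x:{s..t}|lebesgue. u x * \<eta> x + (- (M / m)) * (u x * \<theta> x))"
      by (simp add: \<zeta>_def algebra_simps)
    also have "\<dots> = (LINT x:{s..t}|lebesgue. u x * \<eta> x) + (- (M / m)) * (LINT x:{s..t}|lebesgue. u x * \<theta> x)"
      by (rule lin[OF integrable[OF \<eta>] integrable[OF \<theta>]])
    also have "(LINT x:{s..t}|lebesgue. u x * \<eta> x) = (LINT x:{p..q}|lebesgue. u x * \<eta> x)"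
      by (rule set_lebesgue_integral_eq_of_support) (use st \<eta>0 in auto)
    also have "(LINT x:{s..t}|lebesgue. u x * \<theta> x) = (LINT x:{p0..q0}|lebesgue. u x * \<theta> x)"
      by (rule set_lebesgue_integral_eq_of_support) (use st \<theta>0 in auto)
    finally show ?thesis using \<open>m \<noteq> 0\<close> by (simp add: \<kappa>_def M_def field_simps)
  qed
  have avg: "integral {p..q} u = \<kappa> * (q - p)" if pq: "p < q" "{p..q} \<subseteq> J" for p q
  proof -
    have "bump p q (real (Suc n)) x = 0" if "x \<notin> {p..q}" for n x
      by (rule bump_eq_0) (use that in auto)
    then have "(\<lambda>n. LINT x:{p..q}|lebesgue. u x * bump p q (real (Suc n)) x)
            = (\<lambda>n. \<kappa> * (LINT x:{p..q}|lebesgue. 1 * bump p q (real (Suc n)) x))"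
      using main[OF pq bump_flat_algebra] by (simp del: of_nat_Suc)
    moreover have "(\<lambda>n. \<kappa> * (LINT x:{p..q}|lebesgue. 1 * bump p q (real (Suc n)) x))
        \<longlonglongrightarrow> \<kappa> * integral {p..q} (\<lambda>_. 1)"
      by (intro tendsto_mult tendsto_const integral_bump_limit
          absolutely_integrable_continuous_real continuous_on_const)
    ultimately have "integral {p..q} u = \<kappa> * integral {p..q} (\<lambda>_. 1)"
      using LIMSEQ_unique[OF integral_bump_limit[OF int_u[OF pq(2)]]] by metis
    then show ?thesis using pq(1) by simp
  qed
  \<comment> \<open>the exceptional null set depends on the interval; rational endpoints leave countably many\<close>
  have "AE x in lebesgue. x \<in> {p<..<q} \<longrightarrow> u x = \<kappa>" if "{p..q} \<subseteq> J" for p q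
  proof (rule AE_eq_const_of_interval_integrals)
    show "u integrable_on {p..q}"
      using int_u[OF that] by (rule set_lebesgue_integral_eq_integral(1))
    show "integral {x..y} u = \<kappa> * (y - x)" if "p \<le> x" "x < y" "y \<le> q" for x y
      by (rule avg) (use that \<open>{p..q} \<subseteq> J\<close> in \<open>auto simp: subset_eq\<close>)
  qed
  then have "AE x in lebesgue. \<forall>p q :: rat. {of_rat p..of_rat q} \<subseteq> J \<longrightarrow>
      x \<in> {of_rat p<..<of_rat q} \<longrightarrow> u x = \<kappa>"
    by (auto simp: AE_all_countable)
  then have "AE x in lebesgue. x \<in> J \<longrightarrow> u x = \<kappa>"
  proof (rule eventually_mono, intro impI)
    fix x
    assume *: "\<forall>p q :: rat. {of_rat p..of_rat q} \<subseteq> J \<longrightarrow> x \<in> {of_rat p<..<of_rat q} \<longrightarrow> u x = \<kappa>"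
      and "x \<in> J"
    then obtain e where e: "e > 0" "cball x e \<subseteq> J" using J(1) open_contains_cball by blast
    obtain p q where "x - e < of_rat p" "of_rat p < x" "x < of_rat q" "of_rat q < x + e"
      using of_rat_dense[of "x - e" x] of_rat_dense[of x "x + e"] e(1) by auto
    moreover from this have "{of_rat p..of_rat q} \<subseteq> J"
      using e(2) by (force simp: cball_eq_atLeastAtMost subset_eq)
    ultimately show "u x = \<kappa>" using * by auto
  qed
  then show ?thesis ..
qed simp

section \<open>From weak to classical derivatives\<close>

text \<open>
  The interval that contains the support can be taken strictly inside \<open>(a, b)\<close>, so that \<open>\<psi>\<close>
  vanishes at its end points and boundary terms disappear in integrations by parts.
\<close>
lemma test_functionE:
  assumes \<psi>: "test_function {a<..<b} \<psi>" and "a < b"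
  obtains s t where "a < s" "s < t" "t < b"
    "\<And>x. x \<notin> {s<..<t} \<Longrightarrow> \<psi> x = 0" "\<And>x. x \<notin> {s<..<t} \<Longrightarrow> deriv \<psi> x = 0"
proof -
  define K where "K = closure {x. \<psi> x \<noteq> 0}"
  have K: "compact K" "K \<subseteq> {a<..<b}"
    using \<psi> by (auto simp: test_function_def K_def)
  obtain s t where st: "a < s" "s < t" "t < b" "K \<subseteq> {s<..<t}"
  proof (cases "K = {}")
    case True
    then show ?thesis using that[of "(2 * a + b) / 3" "(a + 2 * b) / 3"] \<open>a < b\<close> by auto
  next
    case False
    obtain k l where kl: "k \<in> K" "\<And>x. x \<in> K \<Longrightarrow> k \<le> x" "l \<in> K" "\<And>x. x \<in> K \<Longrightarrow> x \<le> l"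
      using compact_attains_inf[OF K(1) False] compact_attains_sup[OF K(1) False] by metis
    have "a < k" "l < b" using kl(1,3) K(2) by auto
    moreover have "k \<le> l" using kl(1,4) by simp
    moreover have "(a + k) / 2 < x \<and> x < (l + b) / 2" if "x \<in> K" for x
      using kl(2,4)[OF that] calculation by simp
    ultimately show ?thesis using that[of "(a + k) / 2" "(l + b) / 2"] by (simp add: subset_iff)
  qed
  have zero: "\<psi> x = 0" if "x \<notin> K" for x
    using that closure_subset[of "{x. \<psi> x \<noteq> 0}"] by (auto simp: K_def)
  have "deriv \<psi> x = 0" if "x \<notin> K" for x
  proof (rule DERIV_imp_deriv)
    have "((\<lambda>_. 0) has_real_derivative 0) (at x)" by simp
    moreover have "open (- K)" using K(1) by (simp add: compact_imp_closed open_Compl)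
    ultimately show "(\<psi> has_real_derivative 0) (at x)"
      by (rule has_field_derivative_transform_within_open) (simp_all add: that zero)
  qed
  moreover have "x \<notin> K" if "x \<notin> {s<..<t}" for x using that st(4) by blast
  ultimately show ?thesis using that[OF st(1-3)] zero by simp
qed

lemma test_function_mono:
  "test_function U \<psi> \<Longrightarrow> U \<subseteq> V \<Longrightarrow> test_function V \<psi>"
  unfolding test_function_def by blast

lemma test_function_derivative:
  assumes "test_function U \<psi>"
  shows "(\<psi> has_real_derivative deriv \<psi> x) (at x)" "continuous_on S \<psi>" "continuous_on S (deriv \<psi>)"
proof -
  have diff: "(deriv ^^ n) \<psi> differentiable (at x)" for n x
    using assms by (auto simp: test_function_def)
  show "(\<psi> has_real_derivative deriv \<psi> x) (at x)"
    using diff[of 0 x] by (simp add: DERIV_deriv_iff_real_differentiable)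
  show "continuous_on S \<psi>"
    using diff[of 0] by (auto intro!: continuous_at_imp_continuous_on differentiable_imp_continuous_within)
  show "continuous_on S (deriv \<psi>)"
    using diff[of 1] by (auto intro!: continuous_at_imp_continuous_on differentiable_imp_continuous_within)
qed

lemma locally_integrable_continuous:
  assumes "continuous_on U g"
  shows "locally_integrable_on g U"
  unfolding locally_integrable_on_def
proof (intro allI impI)
  fix K assume K: "compact K \<and> K \<subseteq> U"
  then have "integrable lborel (\<lambda>x. indicator K x *\<^sub>R g x)"
    by (intro borel_integrable_compact continuous_on_subset[OF assms]) auto
  then show "set_integrable lebesgue K g"
    unfolding set_integrable_def
    by (subst integrable_completion) (auto dest: borel_measurable_integrable)
qed

lemma continuous_AE_const:
  fixes h :: "real \<Rightarrow> real"
  assumes h: "continuous_on {a<..<b} h" and ae: "AE x in lebesgue. x \<in> {a<..<b} \<longrightarrow> h x = \<kappa>"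
    and x: "x \<in> {a<..<b}"
  shows "h x = \<kappa>"
proof (rule ccontr)
  assume "h x \<noteq> \<kappa>"
  have "open ({a<..<b} \<inter> h -` (- {\<kappa>}))"
    by (intro continuous_open_preimage[OF h]) auto
  then obtain e where e: "e > 0" "cball x e \<subseteq> {a<..<b} \<inter> h -` (- {\<kappa>})"
    using x \<open>h x \<noteq> \<kappa>\<close> open_contains_cball[of "{a<..<b} \<inter> h -` (- {\<kappa>})"] by blast
  have "AE z in lebesgue. z \<notin> cbox (x - e) (x + e)"
    using ae
  proof (rule eventually_mono)
    fix z assume *: "z \<in> {a<..<b} \<longrightarrow> h z = \<kappa>"
    show "z \<notin> cbox (x - e) (x + e)"
    proof
      assume "z \<in> cbox (x - e) (x + e)"
      then have "z \<in> cball x e" by (simp add: cball_eq_atLeastAtMost)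
      then show False using * e(2) by blast
    qed
  qed
  then have "negligible (cbox (x - e) (x + e))"
    by (simp add: negligible_iff_null_sets AE_iff_null_sets)
  then have "box (x - e) (x + e) = {}" by (simp only: negligible_interval)
  then show False using e(1) by simp
qed

text \<open>
  Near \<open>x\<close> the function \<open>w\<close> has a classical primitive \<open>W\<close>.  The difference \<open>\<phi> - W\<close> has weak derivative
  zero, so it is constant by the du Bois-Reymond lemma and continuity.
\<close>
lemma weak_derivative_continuous_imp_derivative:
  assumes "open U" and wd: "weak_derivative_on U \<phi> v"
    and \<phi>: "continuous_on U \<phi>" and w: "continuous_on U w"
    and ae: "AE x in lebesgue. x \<in> U \<longrightarrow> v x = w x" and "x \<in> U"
  shows "(\<phi> has_real_derivative w x) (at x)"
proof -
  obtain e where e: "e > 0" "cball x e \<subseteq> U"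
    using \<open>open U\<close> \<open>x \<in> U\<close> open_contains_cball by blast
  define a b where "a = x - e" and "b = x + e"
  have ab: "a < x" "x < b" "{a<..<b} \<subseteq> U" "{a<..<b} \<subseteq> {a..b}" "{a..b} \<subseteq> U"
    using e by (auto simp: a_def b_def cball_eq_atLeastAtMost)
  have "isCont w y" if "a < y" "y < b" for y
    using continuous_on_subset[OF w ab(3)] that by (simp add: continuous_on_eq_continuous_at)
  then obtain W where "\<forall>y. a < y \<longrightarrow> y < b \<longrightarrow> (W has_vector_derivative w y) (at y)"
    using einterval_antiderivative[of a b w] ab by auto
  then have W: "(W has_real_derivative w y) (at y)" if "a < y" "y < b" for y
    using that by (simp add: has_real_derivative_iff_has_vector_derivative)
  have contW: "continuous_on {a<..<b} W"
    by (rule continuous_at_imp_continuous_on) (use DERIV_isCont[OF W] in auto)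
  define h where "h y = \<phi> y - W y" for y
  have conth: "continuous_on {a<..<b} h"
    unfolding h_def by (intro continuous_intros continuous_on_subset[OF \<phi>] ab contW)
  have orth: "(LINT y:{a<..<b}|lebesgue. h y * deriv \<psi> y) = 0" if \<psi>: "test_function {a<..<b} \<psi>" for \<psi>
  proof -
    obtain s t where st: "a < s" "s < t" "t < b"
      "\<And>y. y \<notin> {s<..<t} \<Longrightarrow> \<psi> y = 0" "\<And>y. y \<notin> {s<..<t} \<Longrightarrow> deriv \<psi> y = 0"
      using test_functionE[OF \<psi>] ab by auto
    have stab: "{s..t} \<subseteq> {a<..<b}" and stU: "{s..t} \<subseteq> U" using st ab by auto
    have stz: "\<psi> y = 0" "deriv \<psi> y = 0" if "y \<notin> {s..t}" for y
      using that st(4,5)[of y] by auto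
    note d\<psi> = test_function_derivative[OF \<psi>]
    have int: "set_integrable lebesgue {s..t} (\<lambda>y. g y * k y)"
      if "continuous_on {s..t} g" "continuous_on {s..t} k" for g k :: "real \<Rightarrow> real"
      using that by (intro absolutely_integrable_continuous_real continuous_intros)
    have c\<phi>: "continuous_on {s..t} \<phi>" and cW: "continuous_on {s..t} W" and cw: "continuous_on {s..t} w"
      by (rule continuous_on_subset[OF \<phi> stU] continuous_on_subset[OF contW stab]
          continuous_on_subset[OF w stU])+
    have int_v: "set_integrable lebesgue {s..t} v"
      using wd stU by (auto simp: weak_derivative_on_def locally_integrable_on_def)
    have "((\<lambda>y. w y * \<psi> y + W y * deriv \<psi> y) has_integral W t * \<psi> t - W s * \<psi> s) {s..t}"
    proof (rule fundamental_theorem_of_calculus)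
      fix y assume "y \<in> {s..t}"
      then have "(W has_real_derivative w y) (at y)" using W st by auto
      from DERIV_mult[OF this d\<psi>(1)[of y]]
      have "((\<lambda>y. W y * \<psi> y) has_real_derivative w y * \<psi> y + W y * deriv \<psi> y) (at y)"
        by (simp add: algebra_simps)
      then show "((\<lambda>y. W y * \<psi> y) has_vector_derivative w y * \<psi> y + W y * deriv \<psi> y) (at y within {s..t})"
        by (simp add: has_real_derivative_iff_has_vector_derivative has_vector_derivative_at_within)
    qed (use st in auto)
    then have "integral {s..t} (\<lambda>y. w y * \<psi> y + W y * deriv \<psi> y) = 0"
      using st by (simp add: integral_unique)
    moreover have "integral {s..t} (\<lambda>y. w y * \<psi> y + W y * deriv \<psi> y)
        = (LINT y:{s..t}|lebesgue. w y * \<psi> y + W y * deriv \<psi> y)"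
      by (intro set_lebesgue_integral_eq_integral(2)[symmetric] set_integral_add int cw cW d\<psi>)
    moreover have "\<dots> = (LINT y:{s..t}|lebesgue. w y * \<psi> y) + (LINT y:{s..t}|lebesgue. W y * deriv \<psi> y)"
      by (intro set_integral_add int cw cW d\<psi>)
    ultimately have parts: "(LINT y:{s..t}|lebesgue. W y * deriv \<psi> y) = - (LINT y:{s..t}|lebesgue. w y * \<psi> y)"
      by simp
    have "(LINT y:{s..t}|lebesgue. \<phi> y * deriv \<psi> y) = (LINT y:U|lebesgue. \<phi> y * deriv \<psi> y)"
      by (rule set_lebesgue_integral_eq_of_support[symmetric]) (use stU stz in auto)
    also have "\<dots> = - (LINT y:U|lebesgue. v y * \<psi> y)"
      using wd test_function_mono[OF \<psi> ab(3)] by (auto simp: weak_derivative_on_def)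
    also have "(LINT y:U|lebesgue. v y * \<psi> y) = (LINT y:{s..t}|lebesgue. v y * \<psi> y)"
      by (rule set_lebesgue_integral_eq_of_support) (use stU stz in auto)
    also have "\<dots> = (LINT y:{s..t}|lebesgue. w y * \<psi> y)"
      unfolding set_lebesgue_integral_def
    proof (rule integral_cong_AE)
      show "AE y in lebesgue. indicat_real {s..t} y *\<^sub>R (v y * \<psi> y) = indicat_real {s..t} y *\<^sub>R (w y * \<psi> y)"
        using ae by (rule eventually_mono) (use stU in \<open>auto simp: indicator_def\<close>)
    qed (use int[OF cw d\<psi>(2)] set_integrable_times_continuous[OF int_v d\<psi>(2)]
          in \<open>simp_all only: set_integrable_def borel_measurable_integrable\<close>)
    finally have \<phi>_parts: "(LINT y:{s..t}|lebesgue. \<phi> y * deriv \<psi> y) = - (LINT y:{s..t}|lebesgue. w y * \<psi> y)" .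
    have "(LINT y:{a<..<b}|lebesgue. h y * deriv \<psi> y) = (LINT y:{s..t}|lebesgue. h y * deriv \<psi> y)"
      by (rule set_lebesgue_integral_eq_of_support) (use stab stz in auto)
    also have "\<dots> = (LINT y:{s..t}|lebesgue. \<phi> y * deriv \<psi> y - W y * deriv \<psi> y)"
      by (simp add: h_def algebra_simps)
    also have "\<dots> = (LINT y:{s..t}|lebesgue. \<phi> y * deriv \<psi> y) - (LINT y:{s..t}|lebesgue. W y * deriv \<psi> y)"
      by (intro set_integral_diff int c\<phi> cW d\<psi>)
    finally show ?thesis using parts \<phi>_parts by simp
  qed
  have "\<exists>\<kappa>. AE y in lebesgue. y \<in> {a<..<b} \<longrightarrow> h y = \<kappa>"
    by (intro du_Bois_Reymond orth locally_integrable_continuous conth) (auto simp: is_interval_oo)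
  then obtain \<kappa> where "AE y in lebesgue. y \<in> {a<..<b} \<longrightarrow> h y = \<kappa>" ..
  note const = continuous_AE_const[OF conth this]
  have eq: "W y + \<kappa> = \<phi> y" if "y \<in> {a<..<b}" for y
    using const[OF that] by (simp add: h_def)
  have "((\<lambda>y. W y + \<kappa>) has_real_derivative w x) (at x)"
    using W[of x] ab by (auto intro!: derivative_eq_intros)
  then show ?thesis
    by (rule has_field_derivative_transform_within_open[where S="{a<..<b}"]) (use ab eq in auto)
qed

section \<open>The profile equation\<close>

text \<open>
  The profile equation integrated once, with \<open>K\<close> as the constant of integration.  The second part
  covers stretches where \<open>\<phi>\<close> is constant: if \<open>E\<close> vanishes at the value \<open>l\<close>, the first part says
  nothing there, but the flux \<open>E(\<phi>) \<phi>'\<close> is then zero almost everywhere.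
\<close>
lemma traveling_wave_first_integral:
  assumes tw: "traveling_wave_profile f E c UNIV \<phi>"
    and f: "continuous_on {0..1} f" and E: "continuous_on {0..1} E"
  shows "\<exists>K. (\<forall>x. E (\<phi> x) \<noteq> 0 \<longrightarrow>
               (\<phi> has_real_derivative (f (\<phi> x) - c * \<phi> x - K) / E (\<phi> x)) (at x)) \<and>
             (\<forall>a b l. a < b \<longrightarrow> (\<forall>x\<in>{a<..<b}. \<phi> x = l) \<longrightarrow> f l - c * l = K)"
proof -
  have "range \<phi> \<subseteq> {0..1}" and \<phi>: "continuous_on UNIV \<phi>"
    using tw unfolding traveling_wave_profile_def by blast+
  then have range: "\<phi> x \<in> {0..1}" for x by blast
  define U where "U = {\<xi>. E (\<phi> \<xi>) \<noteq> 0}"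
  have "U = {\<xi>\<in>UNIV. E (\<phi> \<xi>) \<noteq> 0}" by (simp add: U_def)
  then obtain v where wd: "weak_derivative_on U \<phi> v"
    and li: "locally_integrable_on (\<lambda>\<xi>. E (\<phi> \<xi>) * v \<xi>) UNIV"
    and eq: "\<And>\<psi>. test_function UNIV \<psi> \<Longrightarrow>
       (LINT \<xi>:UNIV|lebesgue. (E (\<phi> \<xi>) * v \<xi> - f (\<phi> \<xi>) + c * \<phi> \<xi>) * deriv \<psi> \<xi>) = 0"
    using tw unfolding traveling_wave_profile_def by (elim conjE exE) simp
  have f\<phi>: "continuous_on UNIV (\<lambda>x. f (\<phi> x))" and E\<phi>: "continuous_on UNIV (\<lambda>x. E (\<phi> x))"
    using range by (auto intro!: continuous_on_compose2[OF f \<phi>] continuous_on_compose2[OF E \<phi>])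
  have "open U"
    unfolding U_def using open_Collect_neq[OF E\<phi> continuous_on_const[of UNIV 0]] by simp
  have "locally_integrable_on (\<lambda>\<xi>. E (\<phi> \<xi>) * v \<xi> - f (\<phi> \<xi>) + c * \<phi> \<xi>) UNIV"
    unfolding locally_integrable_on_def
  proof (intro allI impI)
    fix S :: "real set" assume S: "compact S \<and> S \<subseteq> UNIV"
    have *: "set_integrable lebesgue S (\<lambda>\<xi>. f (\<phi> \<xi>))" "set_integrable lebesgue S (\<lambda>\<xi>. c * \<phi> \<xi>)"
      using locally_integrable_continuous[OF f\<phi>]
        locally_integrable_continuous[OF continuous_on_mult_left[OF \<phi>, of c]] S
      by (auto simp: locally_integrable_on_def)
    show "set_integrable lebesgue S (\<lambda>\<xi>. E (\<phi> \<xi>) * v \<xi> - f (\<phi> \<xi>) + c * \<phi> \<xi>)"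
      using li S * by (intro set_integral_add(1) set_integral_diff(1)) (auto simp: locally_integrable_on_def)
  qed
  then have "\<exists>\<kappa>. AE x in lebesgue. x \<in> UNIV \<longrightarrow> E (\<phi> x) * v x - f (\<phi> x) + c * \<phi> x = \<kappa>"
    by (intro du_Bois_Reymond eq) auto
  then obtain \<kappa> where \<kappa>: "AE x in lebesgue. E (\<phi> x) * v x - f (\<phi> x) + c * \<phi> x = \<kappa>"
    by auto
  define w where "w x = (f (\<phi> x) - c * \<phi> x - (- \<kappa>)) / E (\<phi> x)" for x
  have w: "(\<phi> has_real_derivative w x) (at x)" if "E (\<phi> x) \<noteq> 0" for x
  proof (rule weak_derivative_continuous_imp_derivative[OF \<open>open U\<close> wd])
    show "continuous_on U w" unfolding w_def
      by (intro continuous_intros continuous_on_subset[OF f\<phi>] continuous_on_subset[OF E\<phi>]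
          continuous_on_subset[OF \<phi>]) (auto simp: U_def)
    show "AE x in lebesgue. x \<in> U \<longrightarrow> v x = w x"
      using \<kappa> by (rule eventually_mono) (auto simp: U_def w_def field_simps)
  qed (use that \<phi> continuous_on_subset in \<open>auto simp: U_def\<close>)
  have "f l - c * l = - \<kappa>" if "a < b" and l: "\<forall>x\<in>{a<..<b}. \<phi> x = l" for a b l
  proof (cases "E l = 0")
    case True
    have "AE x in lebesgue. x \<in> {a<..<b} \<longrightarrow> f l - c * l = - \<kappa>"
      using \<kappa> by (rule eventually_mono) (use l True in auto)
    from continuous_AE_const[OF continuous_on_const this, of "(a + b) / 2"] \<open>a < b\<close>
    show ?thesis by simp
  next
    case False
    define x where "x = (a + b) / 2"
    have x: "x \<in> {a<..<b}" using \<open>a < b\<close> by (simp add: x_def)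
    have "((\<lambda>_. l) has_real_derivative 0) (at x)" by simp
    then have "(\<phi> has_real_derivative 0) (at x)"
      by (rule has_field_derivative_transform_within_open[where S="{a<..<b}"]) (use x l in auto)
    moreover have "(\<phi> has_real_derivative w x) (at x)" using w False x l by auto
    ultimately have "w x = 0" by (rule DERIV_unique[symmetric])
    then show ?thesis using False x l by (simp add: w_def)
  qed
  then show ?thesis using w unfolding w_def by blast
qed

lemma eventually_at_left_less: "\<forall>\<^sub>F y in at_left x. y < x"
  by (simp add: eventually_at_filter)

lemma wavefront_profile_bounds:
  assumes "wavefront_profile f E c lm lp \<phi>"
  shows "mono \<phi>" "continuous_on UNIV \<phi>" "\<phi> x \<in> {0..1}" "lm \<le> \<phi> x" "\<phi> x \<le> lp"
proof -
  have tw: "traveling_wave_profile f E c UNIV \<phi>" and mono: "mono \<phi>"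
    and lim: "(\<phi> \<longlongrightarrow> lm) at_bot" "(\<phi> \<longlongrightarrow> lp) at_top"
    using assms unfolding wavefront_profile_def by blast+
  show "mono \<phi>" by (rule mono)
  show "continuous_on UNIV \<phi>" "\<phi> x \<in> {0..1}"
    using tw unfolding traveling_wave_profile_def by blast+
  show "lm \<le> \<phi> x"
    by (rule tendsto_upperbound[OF lim(1)])
       (auto intro: eventually_mono[OF eventually_le_at_bot[of x]] monoD[OF mono])
  show "\<phi> x \<le> lp"
    by (rule tendsto_lowerbound[OF lim(2)])
       (auto intro: eventually_mono[OF eventually_ge_at_top[of x]] monoD[OF mono])
qed

text \<open>
  The speed is not a free parameter: the sign change of \<open>E\<close> at \<open>\<alpha>\<close> and the limit at \<open>-\<infinity>\<close> force
  \<open>f r - c r - K\<close> to vanish at \<open>\<alpha>\<close> and at \<open>lm\<close>, so \<open>c\<close> and \<open>K\<close> are read off from the chord of \<open>f\<close> over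
  \<open>[lm, \<alpha>]\<close>.  The numerator \<open>h\<close> is therefore the same for every diffusivity \<open>E\<close>, and the same on
  both sides of the origin.
\<close>
lemma wavefront_profile_ode:
  assumes wp: "wavefront_profile f E c lm lp \<phi>" and norm: "normalized_at \<alpha> \<phi>"
    and f: "continuous_on {0..1} f" and E: "continuous_on {0..1} E"
    and pos: "\<And>r. 0 < r \<Longrightarrow> r < \<alpha> \<Longrightarrow> E r > 0" and neg: "\<And>r. \<alpha> < r \<Longrightarrow> r < 1 \<Longrightarrow> E r < 0"
    and l: "0 \<le> lm" "lm < \<alpha>" "\<alpha> < lp" "lp \<le> 1"
  defines "s \<equiv> (f \<alpha> - f lm) / (\<alpha> - lm)"
  defines "h \<equiv> \<lambda>r. f r - (s * (r - \<alpha>) + f \<alpha>)"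
  shows "(x < 0 \<and> lm < \<phi> x) \<or> (0 < x \<and> \<phi> x < lp) \<Longrightarrow>
     (\<phi> has_real_derivative h (\<phi> x) / E (\<phi> x)) (at x)"
proof -
  note b = wavefront_profile_bounds[OF wp]
  have tw: "traveling_wave_profile f E c UNIV \<phi>" and lim: "(\<phi> \<longlongrightarrow> lm) at_bot"
    using wp unfolding wavefront_profile_def by blast+
  have n: "\<phi> 0 = \<alpha>" "\<And>x. x < 0 \<Longrightarrow> \<phi> x < \<alpha>" "\<And>x. 0 < x \<Longrightarrow> \<alpha> < \<phi> x"
    using norm by (auto simp: normalized_at_def)
  obtain K where K: "\<forall>x. E (\<phi> x) \<noteq> 0 \<longrightarrow>
               (\<phi> has_real_derivative (f (\<phi> x) - c * \<phi> x - K) / E (\<phi> x)) (at x)"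
     "\<forall>a b l. a < b \<longrightarrow> (\<forall>x\<in>{a<..<b}. \<phi> x = l) \<longrightarrow> f l - c * l = K"
    using traveling_wave_first_integral[OF tw f E] by blast
  define g where "g r = f r - c * r - K" for r
  have contg: "continuous_on {0..1} g"
    unfolding g_def by (intro continuous_intros f)
  have left: "E (\<phi> x) > 0" if "x < 0" "lm < \<phi> x" for x
    using pos[of "\<phi> x"] n(2)[of x] that l by auto
  have right: "E (\<phi> x) < 0" if "0 < x" "\<phi> x < lp" for x
    using neg[of "\<phi> x"] n(3)[of x] that l by auto
  have der: "(\<phi> has_real_derivative g (\<phi> x) / E (\<phi> x)) (at x)" if "E (\<phi> x) \<noteq> 0" for x
    using K(1) that by (simp add: g_def)
  have quot: "g (\<phi> x) / E (\<phi> x) \<ge> 0" if "E (\<phi> x) \<noteq> 0" for x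
    using mono_on_imp_deriv_nonneg[of UNIV \<phi>, OF _ der[OF that]] b(1) by (simp add: mono_on_def mono_def)
  have gleft: "g (\<phi> x) \<ge> 0" if "x < 0" "lm < \<phi> x" for x
    using quot[of x] left[OF that] by (simp add: zero_le_divide_iff)
  have gright: "g (\<phi> x) \<le> 0" if "0 < x" "\<phi> x < lp" for x
    using quot[of x] right[OF that] by (simp add: zero_le_divide_iff)
  have g\<phi>: "((\<lambda>x. g (\<phi> x)) \<longlongrightarrow> g r) F" if "(\<phi> \<longlongrightarrow> r) F" "r \<in> {0..1}" for r F
    by (rule continuous_on_tendsto_compose[OF contg that]) (use b(3) in auto)
  have "isCont \<phi> 0" using b(2) by (simp add: continuous_on_eq_continuous_at)
  then have \<phi>0: "(\<phi> \<longlongrightarrow> \<alpha>) (at_left 0)" "(\<phi> \<longlongrightarrow> \<alpha>) (at_right 0)"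
    using n(1) by (auto simp: isCont_def filterlim_at_split)
  \<comment> \<open>\<open>g(\<phi>)\<close> is \<open>E(\<phi>)\<close> times the slope of \<open>\<phi>\<close>: nonnegative to the left of the origin, nonpositive to its right\<close>
  have "\<forall>\<^sub>F x in at_left 0. g (\<phi> x) \<ge> 0"
    using order_tendstoD(1)[OF \<phi>0(1) l(2)] eventually_at_left_less[of "0::real"]
    by eventually_elim (use gleft in auto)
  then have "g \<alpha> \<ge> 0"
    by (intro tendsto_lowerbound[OF g\<phi>[OF \<phi>0(1)]]) (use l in auto)
  moreover have "\<forall>\<^sub>F x in at_right 0. g (\<phi> x) \<le> 0"
    using order_tendstoD(2)[OF \<phi>0(2) l(3)] eventually_at_right_less[of "0::real"]
    by eventually_elim (use gright in auto)
  then have "g \<alpha> \<le> 0"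
    by (intro tendsto_upperbound[OF g\<phi>[OF \<phi>0(2)]]) (use l in auto)
  ultimately have g\<alpha>: "g \<alpha> = 0" by simp
  have glm: "g lm = 0"
  proof (cases "\<exists>N. \<phi> N = lm")
    case True
    \<comment> \<open>the profile is sharp: it is constant on a half-line\<close>
    then obtain N where "\<phi> N = lm" ..
    have "\<phi> x = lm" if "x < N" for x
      using b(4)[of x] monoD[OF b(1), of x N] that \<open>\<phi> N = lm\<close> by simp
    then show ?thesis using K(2)[rule_format, of "N - 1" N lm] by (simp add: g_def)
  next
    case False
    then have above: "lm < \<phi> x" for x using b(4)[of x] by (simp add: less_le) metis
    have glim: "((\<lambda>x. g (\<phi> x)) \<longlongrightarrow> g lm) at_bot"
      by (rule g\<phi>[OF lim]) (use l in auto)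
    have "\<forall>\<^sub>F x in at_bot. g (\<phi> x) \<ge> 0"
      using eventually_le_at_bot[of "-1"] by eventually_elim (use gleft above in auto)
    then have "g lm \<ge> 0" by (intro tendsto_lowerbound[OF glim]) auto
    moreover have "\<not> g lm > 0"
    proof
      assume "g lm > 0"
      have "compact (E ` {0..1})" by (rule compact_continuous_image[OF E compact_Icc])
      then obtain B where B: "B > 0" "\<And>r. r \<in> {0..1} \<Longrightarrow> \<bar>E r\<bar> \<le> B"
        using compact_imp_bounded bounded_pos by (metis imageI real_norm_def)
      \<comment> \<open>near \<open>-\<infinity>\<close> the slope of \<open>\<phi>\<close> is at least \<open>k\<close>; over a length \<open>2 / k\<close> it would climb by \<open>2\<close> inside \<open>[0, 1]\<close>\<close>
      define k where "k = (g lm / 2) / B"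
      have k: "k > 0" using \<open>g lm > 0\<close> B by (simp add: k_def)
      have "\<forall>\<^sub>F x in at_bot. g (\<phi> x) > g lm / 2 \<and> x < 0"
        using order_tendstoD(1)[OF glim, of "g lm / 2"] \<open>g lm > 0\<close> eventually_gt_at_bot[of 0]
        by (auto intro: eventually_conj)
      then obtain N where N: "\<And>x. x \<le> N \<Longrightarrow> g (\<phi> x) > g lm / 2 \<and> x < 0"
        unfolding eventually_at_bot_linorder by blast
      have slope: "k \<le> g (\<phi> x) / E (\<phi> x)" if "x \<le> N" for x
      proof -
        have "0 < E (\<phi> x)" "E (\<phi> x) \<le> B"
          using left[of x] N[OF that] above B(2)[OF b(3)[of x]] by auto
        then show ?thesis unfolding k_def
          using N[OF that] \<open>g lm > 0\<close> by (intro frac_le) auto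
      qed
      have "\<phi> (N - 2 / k) - k * (N - 2 / k) \<le> \<phi> N - k * N"
      proof (rule DERIV_nonneg_imp_nondecreasing[where f="\<lambda>x. \<phi> x - k * x"])
        fix x assume "N - 2 / k \<le> x" "x \<le> N"
        have "E (\<phi> x) \<noteq> 0" using left[of x] above[of x] N[OF \<open>x \<le> N\<close>] by auto
        then have "((\<lambda>x. \<phi> x - k * x) has_real_derivative g (\<phi> x) / E (\<phi> x) - k) (at x)"
          by (auto intro!: derivative_eq_intros der)
        then show "\<exists>y. ((\<lambda>x. \<phi> x - k * x) has_real_derivative y) (at x) \<and> 0 \<le> y"
          using slope[OF \<open>x \<le> N\<close>] by force
      qed (use k in auto)
      then have "\<phi> (N - 2 / k) + 2 \<le> \<phi> N" using k by (simp add: algebra_simps)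
      then show False using b(3)[of N] b(3)[of "N - 2 / k"] by auto
    qed
    ultimately show ?thesis by simp
  qed
  have "c * (\<alpha> - lm) = f \<alpha> - f lm" using g\<alpha> glm by (simp add: g_def algebra_simps)
  then have "s = c" using l by (simp add: s_def field_simps)
  then have hg: "h r = g r" for r using g\<alpha> by (simp add: h_def g_def algebra_simps)
  assume "(x < 0 \<and> lm < \<phi> x) \<or> (0 < x \<and> \<phi> x < lp)"
  then have "E (\<phi> x) \<noteq> 0" using left[of x] right[of x] by auto
  from der[OF this] show "(\<phi> has_real_derivative h (\<phi> x) / E (\<phi> x)) (at x)" by (simp add: hg)
qed

section \<open>Collapse of the layer\<close>

text \<open>
  The primitive \<open>G\<close> of \<open>1/q\<close> measures time along the solutions: \<open>G(\<phi>\<^sub>\<epsilon>)\<close> grows at rate \<open>1/\<epsilon>\<close>.  That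
  the single solution \<open>\<phi>\<^sub>1\<close> reaches \<open>\<alpha>\<close> at the origin bounds \<open>G\<close> from above, and no solution with small
  \<open>\<epsilon>\<close> can then spend the time \<open>\<delta>/2\<close> above a level \<open>r > l\<close>.
\<close>
lemma autonomous_layer_collapse:
  fixes \<phi> :: "real \<Rightarrow> real \<Rightarrow> real"
  assumes "l < \<alpha>" and q: "continuous_on {l<..<\<alpha>} q" "\<And>r. l < r \<Longrightarrow> r < \<alpha> \<Longrightarrow> q r > 0"
    and mono: "\<And>\<epsilon>. 0 < \<epsilon> \<Longrightarrow> \<epsilon> \<le> 1 \<Longrightarrow> mono (\<phi> \<epsilon>)"
    and lim: "(\<phi> 1 \<longlongrightarrow> \<alpha>) (at_left 0)"
    and lower: "\<And>\<epsilon> \<xi>. 0 < \<epsilon> \<Longrightarrow> \<epsilon> \<le> 1 \<Longrightarrow> l \<le> \<phi> \<epsilon> \<xi>"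
    and upper: "\<And>\<epsilon> \<xi>. 0 < \<epsilon> \<Longrightarrow> \<epsilon> \<le> 1 \<Longrightarrow> \<xi> < 0 \<Longrightarrow> \<phi> \<epsilon> \<xi> < \<alpha>"
    and ode: "\<And>\<epsilon> \<xi>. 0 < \<epsilon> \<Longrightarrow> \<epsilon> \<le> 1 \<Longrightarrow> \<xi> < 0 \<Longrightarrow> l < \<phi> \<epsilon> \<xi> \<Longrightarrow>
       (\<phi> \<epsilon> has_real_derivative q (\<phi> \<epsilon> \<xi>) / \<epsilon>) (at \<xi>)"
    and "\<delta> > 0"
  shows "uniform_limit {..<-\<delta>} \<phi> (\<lambda>_. l) (at_right 0)"
proof -
  have "isCont (\<lambda>r. 1 / q r) r" if "l < r" "r < \<alpha>" for r
    using q that by (intro continuous_intros) (auto simp: continuous_on_eq_continuous_at less_imp_neq[symmetric])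
  then have "\<exists>G. \<forall>r. ereal l < ereal r \<longrightarrow> ereal r < ereal \<alpha> \<longrightarrow> (G has_vector_derivative 1 / q r) (at r)"
    using \<open>l < \<alpha>\<close> by (intro einterval_antiderivative) auto
  then obtain G where G: "\<And>r. l < r \<Longrightarrow> r < \<alpha> \<Longrightarrow> (G has_real_derivative 1 / q r) (at r)"
    by (auto simp: has_real_derivative_iff_has_vector_derivative)
  have G_mono: "G r \<le> G r'" if "l < r" "r \<le> r'" "r' < \<alpha>" for r r'
  proof (rule DERIV_nonneg_imp_nondecreasing[OF that(2)])
    fix x assume "r \<le> x" "x \<le> r'"
    then show "\<exists>y. (G has_real_derivative y) (at x) \<and> 0 \<le> y"
      using G[of x] q(2)[of x] that by (intro exI[of _ "1 / q x"]) auto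
  qed
  have clock: "G (\<phi> \<epsilon> \<xi>') = G (\<phi> \<epsilon> \<xi>) + (\<xi>' - \<xi>) / \<epsilon>"
    if \<epsilon>: "0 < \<epsilon>" "\<epsilon> \<le> 1" and \<xi>: "\<xi> < \<xi>'" "\<xi>' < 0" "l < \<phi> \<epsilon> \<xi>" for \<epsilon> \<xi> \<xi>'
  proof -
    have der: "((\<lambda>x. G (\<phi> \<epsilon> x) - x / \<epsilon>) has_real_derivative 0) (at x)" if "\<xi> \<le> x" "x \<le> \<xi>'" for x
    proof -
      have x: "x < 0" "l < \<phi> \<epsilon> x" "\<phi> \<epsilon> x < \<alpha>"
        using that \<xi> monoD[OF mono[OF \<epsilon>] that(1)] upper[OF \<epsilon>, of x] by auto
      from DERIV_chain2[OF G[OF x(2,3)] ode[OF \<epsilon> x(1,2)]]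
      have "((\<lambda>x. G (\<phi> \<epsilon> x)) has_real_derivative 1 / \<epsilon>) (at x)"
        using q(2)[OF x(2,3)] by simp
      from DERIV_diff[OF this DERIV_cdivide[OF DERIV_ident, where c=\<epsilon>]] show ?thesis by simp
    qed
    have "continuous_on {\<xi>..\<xi>'} (\<lambda>x. G (\<phi> \<epsilon> x) - x / \<epsilon>)"
      by (intro continuous_at_imp_continuous_on ballI DERIV_isCont[OF der]) auto
    from DERIV_isconst_end[OF \<xi>(1) this der]
    have "G (\<phi> \<epsilon> \<xi>') - \<xi>' / \<epsilon> = G (\<phi> \<epsilon> \<xi>) - \<xi> / \<epsilon>" by simp
    then show ?thesis by (simp add: diff_divide_distrib)
  qed
  have reach: "\<exists>\<xi><0. r < \<phi> 1 \<xi>" if "r < \<alpha>" for r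
  proof -
    have "\<forall>\<^sub>F \<xi> in at_left 0. r < \<phi> 1 \<xi> \<and> \<xi> < 0"
      using order_tendstoD(1)[OF lim that] eventually_at_left_less[of "0::real"]
      by (auto elim: eventually_elim2)
    from eventually_happens[OF this] show ?thesis by auto
  qed
  obtain \<xi>0 where \<xi>0: "\<xi>0 < 0" "l < \<phi> 1 \<xi>0" using reach[OF \<open>l < \<alpha>\<close>] by blast
  define B where "B = G (\<phi> 1 \<xi>0) - \<xi>0"
  have G_le: "G r \<le> B" if r: "l < r" "r < \<alpha>" for r
  proof -
    obtain \<xi>1 where "\<xi>1 < 0" "r < \<phi> 1 \<xi>1" using reach[OF r(2)] by blast
    define \<xi> where "\<xi> = max (\<xi>0 / 2) \<xi>1"
    have \<xi>: "\<xi>0 < \<xi>" "\<xi> < 0" "\<xi>1 \<le> \<xi>" using \<xi>0 \<open>\<xi>1 < 0\<close> by (auto simp: \<xi>_def)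
    have "r \<le> \<phi> 1 \<xi>" using \<open>r < \<phi> 1 \<xi>1\<close> monoD[OF mono[of 1] \<xi>(3)] by simp
    then have "G r \<le> G (\<phi> 1 \<xi>)" using r upper[of 1 \<xi>] \<xi> by (intro G_mono) auto
    also have "\<dots> = G (\<phi> 1 \<xi>0) + (\<xi> - \<xi>0) / 1" by (rule clock) (use \<xi> \<xi>0 in auto)
    finally show ?thesis using \<xi> by (simp add: B_def)
  qed
  show ?thesis
    unfolding uniform_limit_iff
  proof (intro allI impI)
    fix e :: real assume "e > 0"
    define r where "r = min (l + e / 2) ((l + \<alpha>) / 2)"
    have r: "l < r" "r < \<alpha>" "r < l + e" using \<open>e > 0\<close> \<open>l < \<alpha>\<close> by (auto simp: r_def min_def)
    \<comment> \<open>for \<open>\<epsilon> < \<epsilon>0\<close> the gain \<open>\<delta> / (2 * \<epsilon>)\<close> of \<open>G\<close> on \<open>[- \<delta>, - \<delta> / 2]\<close> exceeds \<open>B - G r\<close>;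
        the summand \<open>1\<close> keeps the denominator positive\<close>
    define \<epsilon>0 where "\<epsilon>0 = min 1 (\<delta> / (2 * (B - G r + 1)))"
    have pos: "B - G r + 1 > 0" using G_le[OF r(1,2)] by simp
    have "\<epsilon>0 > 0" using pos \<open>\<delta> > 0\<close> by (simp add: \<epsilon>0_def)
    have "\<forall>\<^sub>F \<epsilon> in at_right 0. 0 < \<epsilon> \<and> \<epsilon> < \<epsilon>0"
      using eventually_at_right_real[OF \<open>\<epsilon>0 > 0\<close>] by (auto elim: eventually_mono)
    then show "\<forall>\<^sub>F \<epsilon> in at_right 0. \<forall>\<xi>\<in>{..<-\<delta>}. dist (\<phi> \<epsilon> \<xi>) l < e"
    proof eventually_elim
      case (elim \<epsilon>)
      have \<epsilon>: "0 < \<epsilon>" "\<epsilon> \<le> 1" using elim by (auto simp: \<epsilon>0_def)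
      have "\<phi> \<epsilon> (- \<delta>) \<le> r"
      proof (rule ccontr)
        assume "\<not> \<phi> \<epsilon> (- \<delta>) \<le> r"
        then have gt: "r < \<phi> \<epsilon> (- \<delta>)" by simp
        have "G r + \<delta> / (2 * \<epsilon>) \<le> G (\<phi> \<epsilon> (- \<delta>)) + (- (\<delta> / 2) - (- \<delta>)) / \<epsilon>"
          using G_mono[of r "\<phi> \<epsilon> (- \<delta>)"] r gt upper[OF \<epsilon>, of "- \<delta>"] \<open>\<delta> > 0\<close> by (simp add: field_simps)
        also have "\<dots> = G (\<phi> \<epsilon> (- (\<delta> / 2)))"
          by (rule clock[symmetric]) (use \<epsilon> \<open>\<delta> > 0\<close> gt r in auto)
        also have "\<dots> \<le> B"
        proof (rule G_le)
          show "l < \<phi> \<epsilon> (- (\<delta> / 2))"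
            using monoD[OF mono[OF \<epsilon>], of "- \<delta>" "- (\<delta> / 2)"] gt r \<open>\<delta> > 0\<close> by simp
        qed (use upper[OF \<epsilon>] \<open>\<delta> > 0\<close> in auto)
        finally have "\<delta> / (2 * \<epsilon>) < B - G r + 1" by simp
        moreover have "\<epsilon> < \<delta> / (2 * (B - G r + 1))" using elim by (simp add: \<epsilon>0_def)
        ultimately show False using \<epsilon>(1) pos by (simp add: field_simps)
      qed
      then have "\<phi> \<epsilon> \<xi> \<le> r" if "\<xi> < - \<delta>" for \<xi>
        using monoD[OF mono[OF \<epsilon>], of \<xi> "- \<delta>"] that by simp
      then show ?case using r lower[OF \<epsilon>] by (force simp: dist_real_def)
    qed
  qed
qed

theorem theorem2p3:
  fixes f D :: "real \<Rightarrow> real" and \<alpha> lm lp :: real and \<phi> :: "real \<Rightarrow> real \<Rightarrow> real"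
  assumes "0 < \<alpha>" and "\<alpha> < 1"
    and "C1_on f {0..1}" and "f 0 = 0"
    and "C1_on D {0..1}"
    and "\<And>r. 0 < r \<Longrightarrow> r < \<alpha> \<Longrightarrow> D r > 0"
    and "\<And>r. \<alpha> < r \<Longrightarrow> r < 1 \<Longrightarrow> D r < 0"
    and "deriv D \<alpha> < 0"
    and "0 \<le> lm" and "lm < \<alpha>" and "\<alpha> < lp" and "lp \<le> 1"
    and "(f \<alpha> - f lm) / (\<alpha> - lm) = (f lp - f \<alpha>) / (lp - \<alpha>)"
    and "\<And>r. lm < r \<Longrightarrow> r < \<alpha> \<Longrightarrow> f r > (f \<alpha> - f lm) / (\<alpha> - lm) * (r - \<alpha>) + f \<alpha>"
    and "\<And>r. \<alpha> < r \<Longrightarrow> r < lp \<Longrightarrow> f r < (f lp - f \<alpha>) / (lp - \<alpha>) * (r - \<alpha>) + f \<alpha>"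
    and "\<And>\<epsilon>. 0 < \<epsilon> \<Longrightarrow> \<epsilon> \<le> 1 \<Longrightarrow>
           \<exists>c. wavefront_profile f (\<lambda>r. \<epsilon> * D r) c lm lp (\<phi> \<epsilon>)"
    and "\<And>\<epsilon>. 0 < \<epsilon> \<Longrightarrow> \<epsilon> \<le> 1 \<Longrightarrow> normalized_at \<alpha> (\<phi> \<epsilon>)"
  shows "(\<forall>\<xi><0. ((\<lambda>\<epsilon>. \<phi> \<epsilon> \<xi>) \<longlongrightarrow> lm) (at_right 0)) \<and>
         (\<forall>\<xi>>0. ((\<lambda>\<epsilon>. \<phi> \<epsilon> \<xi>) \<longlongrightarrow> lp) (at_right 0)) \<and>
         (\<forall>\<delta>>0. uniform_limit {..<-\<delta>} \<phi> (\<lambda>_. lm) (at_right 0) \<and>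
                uniform_limit {\<delta><..} \<phi> (\<lambda>_. lp) (at_right 0))"
proof -
  have C1_continuous: "continuous_on {0..1} g" if "C1_on g {0..1}" for g
    using that unfolding C1_on_def by (metis DERIV_continuous_on)
  have f: "continuous_on {0..1} f" and D: "continuous_on {0..1} D"
    using assms(3,5) C1_continuous by blast+
  define s where "s = (f \<alpha> - f lm) / (\<alpha> - lm)"
  define h where "h r = f r - (s * (r - \<alpha>) + f \<alpha>)" for r
  define q where "q r = h r / D r" for r
  have h: "continuous_on {0..1} h" unfolding h_def by (intro continuous_intros f)
  have norm: "\<phi> \<epsilon> 0 = \<alpha>" "\<And>\<xi>. \<xi> < 0 \<Longrightarrow> \<phi> \<epsilon> \<xi> < \<alpha>" "\<And>\<xi>. \<xi> > 0 \<Longrightarrow> \<alpha> < \<phi> \<epsilon> \<xi>"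
    if "0 < \<epsilon>" "\<epsilon> \<le> 1" for \<epsilon>
    using assms(17)[OF that] by (auto simp: normalized_at_def)
  have prof: "mono (\<phi> \<epsilon>)" "continuous_on UNIV (\<phi> \<epsilon>)" "lm \<le> \<phi> \<epsilon> \<xi>" "\<phi> \<epsilon> \<xi> \<le> lp"
    and ode: "(\<xi> < 0 \<and> lm < \<phi> \<epsilon> \<xi>) \<or> (0 < \<xi> \<and> \<phi> \<epsilon> \<xi> < lp) \<Longrightarrow>
      (\<phi> \<epsilon> has_real_derivative q (\<phi> \<epsilon> \<xi>) / \<epsilon>) (at \<xi>)"
    if \<epsilon>: "0 < \<epsilon>" "\<epsilon> \<le> 1" for \<epsilon> \<xi>
  proof -
    obtain c where wp: "wavefront_profile f (\<lambda>r. \<epsilon> * D r) c lm lp (\<phi> \<epsilon>)"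
      using assms(16)[OF \<epsilon>] by blast
    show "mono (\<phi> \<epsilon>)" "continuous_on UNIV (\<phi> \<epsilon>)" "lm \<le> \<phi> \<epsilon> \<xi>" "\<phi> \<epsilon> \<xi> \<le> lp"
      using wavefront_profile_bounds[OF wp] by simp_all
    assume "(\<xi> < 0 \<and> lm < \<phi> \<epsilon> \<xi>) \<or> (0 < \<xi> \<and> \<phi> \<epsilon> \<xi> < lp)"
    then have "(\<phi> \<epsilon> has_real_derivative h (\<phi> \<epsilon> \<xi>) / (\<epsilon> * D (\<phi> \<epsilon> \<xi>))) (at \<xi>)"
      unfolding h_def s_def
      by (intro wavefront_profile_ode[OF wp assms(17)[OF \<epsilon>] f])
         (use \<epsilon> D assms(6,7,9-12) in \<open>auto intro!: continuous_intros mult_pos_neg\<close>)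
    then show "(\<phi> \<epsilon> has_real_derivative q (\<phi> \<epsilon> \<xi>) / \<epsilon>) (at \<xi>)"
      by (simp add: q_def mult.commute)
  qed
  have "isCont (\<phi> 1) 0" using prof(2)[of 1] by (simp add: continuous_on_eq_continuous_at)
  then have lim: "(\<phi> 1 \<longlongrightarrow> \<alpha>) (at_left 0)" "(\<phi> 1 \<longlongrightarrow> \<alpha>) (at_right 0)"
    using norm(1)[of 1] by (auto simp: isCont_def filterlim_at_split)
  have contq: "continuous_on S q" if "S \<subseteq> {0..1}" "\<And>r. r \<in> S \<Longrightarrow> D r \<noteq> 0" for S
    unfolding q_def using that
    by (intro continuous_intros continuous_on_subset[OF h] continuous_on_subset[OF D]) auto
  have left: "uniform_limit {..<-\<delta>} \<phi> (\<lambda>_. lm) (at_right 0)" if "\<delta> > 0" for \<delta>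
  proof (rule autonomous_layer_collapse[where q=q and \<alpha>=\<alpha>])
    have D: "D r > 0" if "lm < r" "r < \<alpha>" for r using assms(6)[of r] that assms(9) by simp
    show "continuous_on {lm<..<\<alpha>} q"
      by (rule contq) (use assms(2,9) D less_imp_neq in fastforce)+
    show "0 < q r" if "lm < r" "r < \<alpha>" for r
      unfolding q_def using D[OF that] assms(14)[OF that] by (intro divide_pos_pos) (simp_all add: h_def s_def)
  qed (use assms(10) lim norm prof ode that in auto)
  have right: "uniform_limit {\<delta><..} \<phi> (\<lambda>_. lp) (at_right 0)" if "\<delta> > 0" for \<delta>
  proof -
    \<comment> \<open>the point reflection \<open>- \<phi>\<^sub>\<epsilon>(-\<xi>)\<close> exchanges the two halves and preserves monotonicity\<close>
    have "uniform_limit {..<-\<delta>} (\<lambda>\<epsilon> \<xi>. - \<phi> \<epsilon> (- \<xi>)) (\<lambda>_. - lp) (at_right 0)"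
    proof (rule autonomous_layer_collapse[where q="\<lambda>r. q (- r)" and \<alpha>="- \<alpha>"])
      have D: "D r < 0" if "\<alpha> < r" "r < lp" for r using assms(7)[of r] that assms(12) by simp
      have "continuous_on {\<alpha><..<lp} q"
        by (rule contq) (use assms(1,12) D less_imp_neq in fastforce)+
      then show "continuous_on {- lp<..<- \<alpha>} (\<lambda>r. q (- r))"
        by (rule continuous_on_compose2) (auto intro!: continuous_intros)
      show "0 < q (- r)" if "- lp < r" "r < - \<alpha>" for r
        unfolding q_def using D[of "- r"] assms(15)[of "- r"] that assms(13)
        by (intro divide_neg_neg) (simp_all add: h_def s_def)
      show "mono (\<lambda>\<xi>. - \<phi> \<epsilon> (- \<xi>))" if "0 < \<epsilon>" "\<epsilon> \<le> 1" for \<epsilon>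
        using prof(1)[OF that] by (simp add: mono_def)
      show "((\<lambda>\<xi>. - \<phi> 1 (- \<xi>)) \<longlongrightarrow> - \<alpha>) (at_left 0)"
        using lim(2) by (intro tendsto_minus) (simp add: filterlim_at_left_to_right)
      show "((\<lambda>\<xi>. - \<phi> \<epsilon> (- \<xi>)) has_real_derivative q (- (- \<phi> \<epsilon> (- \<xi>))) / \<epsilon>) (at \<xi>)"
        if "0 < \<epsilon>" "\<epsilon> \<le> 1" "\<xi> < 0" "- lp < - \<phi> \<epsilon> (- \<xi>)" for \<epsilon> \<xi>
      proof -
        have "(\<phi> \<epsilon> has_real_derivative q (\<phi> \<epsilon> (- \<xi>)) / \<epsilon>) (at (- \<xi>))"
          using that by (intro ode) auto
        from DERIV_minus[OF DERIV_chain2[OF this DERIV_minus[OF DERIV_ident]]]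
        show ?thesis by simp
      qed
    qed (use assms(11) norm prof that in auto)
    then show ?thesis
      unfolding uniform_limit_iff
    proof (intro allI impI)
      fix e :: real
      assume *: "\<forall>e>0. \<forall>\<^sub>F \<epsilon> in at_right 0. \<forall>\<xi>\<in>{..<-\<delta>}. dist (- \<phi> \<epsilon> (- \<xi>)) (- lp) < e" and "e > 0"
      then have "\<forall>\<^sub>F \<epsilon> in at_right 0. \<forall>\<xi>\<in>{..<-\<delta>}. dist (- \<phi> \<epsilon> (- \<xi>)) (- lp) < e" by blast
      then show "\<forall>\<^sub>F \<epsilon> in at_right 0. \<forall>\<xi>\<in>{\<delta><..}. dist (\<phi> \<epsilon> \<xi>) lp < e"
      proof (rule eventually_mono, intro ballI)
        fix \<epsilon> \<xi> assume *: "\<forall>\<xi>\<in>{..<-\<delta>}. dist (- \<phi> \<epsilon> (- \<xi>)) (- lp) < e" and "\<xi> \<in> {\<delta><..}"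
        then show "dist (\<phi> \<epsilon> \<xi>) lp < e" using bspec[OF *, of "- \<xi>"] by (simp add: dist_minus)
      qed
    qed
  qed
  have "((\<lambda>\<epsilon>. \<phi> \<epsilon> \<xi>) \<longlongrightarrow> lm) (at_right 0)" if "\<xi> < 0" for \<xi>
    using tendsto_uniform_limitI[OF left[of "- \<xi> / 2"], of \<xi>] that by simp
  moreover have "((\<lambda>\<epsilon>. \<phi> \<epsilon> \<xi>) \<longlongrightarrow> lp) (at_right 0)" if "\<xi> > 0" for \<xi>
    using tendsto_uniform_limitI[OF right[of "\<xi> / 2"], of \<xi>] that by simp
  ultimately show ?thesis using left right by blast
qed

end
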